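(* Let $G$ be a connected $3$-colorable graph of order $n$. Then $G$ has a proper $3$-coloring of its vertices such that the bad edges, if there are any, all have a common vertex. Hence $\iota^i(G)\le (n+1)/3$.
   Context: Graphs are finite and simple. Given a proper $3$-coloring of all the vertices of $G$, an edge $uv$ of $G$ is called bad if the color that is missing from $\{u,v\}$ (the one of the three colors used on neither $u$ nor $v$) is also missing from all neighbors of $u$ and all neighbors of $v$; otherwise the edge is good. For a set $S$ of vertices, $N[S]$ denotes $S$ together with all neighbors of vertices of $S$. A set $S\subseteq V(G)$ is an isolating set of $G$ if $G-N[S]$ contains no edge. An independent isolating set is an isolating set that is also an independent set. The independent isolation number $\iota^i(G)$ is the minimum size of an independent isolating set of $G$. *)

theory Defs
  imports Complex_Main "Graph_Theory.Digraph_Component"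
begin

text \<open>
  A finite simple graph is a symmetric digraph in the sense of the locale \<^locale>\<open>graph\<close>
  (finite, no loops, no parallel arcs): each undirected edge is a pair of opposite arcs,
  and \<open>u \<rightarrow>\<^bsub>G\<^esub> v\<close> is adjacency.
\<close>

definition nbrs :: "('a, 'b) pre_digraph \<Rightarrow> 'a \<Rightarrow> 'a set" where
  "nbrs G v = {u. v \<rightarrow>\<^bsub>G\<^esub> u}"

definition closed_nbhd :: "('a, 'b) pre_digraph \<Rightarrow> 'a set \<Rightarrow> 'a set" where
  "closed_nbhd G S = S \<union> (\<Union>v\<in>S. nbrs G v)"

definition isolating_set :: "('a, 'b) pre_digraph \<Rightarrow> 'a set \<Rightarrow> bool" where
  "isolating_set G S \<longleftrightarrow>
     S \<subseteq> verts G \<and> arcs (G \<restriction> (verts G - closed_nbhd G S)) = {}"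

definition independent_set :: "('a, 'b) pre_digraph \<Rightarrow> 'a set \<Rightarrow> bool" where
  "independent_set G S \<longleftrightarrow> S \<subseteq> verts G \<and> (\<forall>u\<in>S. \<forall>v\<in>S. \<not> u \<rightarrow>\<^bsub>G\<^esub> v)"

definition independent_isolation_number :: "('a, 'b) pre_digraph \<Rightarrow> nat" where
  "independent_isolation_number G =
     Min {card S | S. independent_set G S \<and> isolating_set G S}"

definition proper_3_coloring :: "('a, 'b) pre_digraph \<Rightarrow> ('a \<Rightarrow> nat) \<Rightarrow> bool" where
  "proper_3_coloring G c \<longleftrightarrow>
     (\<forall>v\<in>verts G. c v \<in> {1, 2, 3}) \<and> (\<forall>u v. u \<rightarrow>\<^bsub>G\<^esub> v \<longrightarrow> c u \<noteq> c v)"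

definition three_colorable :: "('a, 'b) pre_digraph \<Rightarrow> bool" where
  "three_colorable G \<longleftrightarrow> (\<exists>c. proper_3_coloring G c)"

text \<open>Well defined when \<open>u\<close> and \<open>v\<close> carry distinct colors, e.g. when they are adjacent.\<close>

definition missing_color :: "('a \<Rightarrow> nat) \<Rightarrow> 'a \<Rightarrow> 'a \<Rightarrow> nat" where
  "missing_color c u v = (THE k. k \<in> {1, 2, 3} \<and> k \<notin> {c u, c v})"

text \<open>Edges are taken as two-element sets here, so that orientation plays no role.\<close>

definition bad_edges :: "('a, 'b) pre_digraph \<Rightarrow> ('a \<Rightarrow> nat) \<Rightarrow> 'a set set" where
  "bad_edges G c =
     {{u, v} | u v. u \<rightarrow>\<^bsub>G\<^esub> v \<and> (\<forall>w \<in> nbrs G u \<union> nbrs G v. c w \<noteq> missing_color c u v)}"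

text \<open>The minimum in \<^const>\<open>independent_isolation_number\<close> is over a finite nonempty set.\<close>

lemma ex_independent_isolating_set:
  assumes "graph G"
  shows "finite {card S | S. independent_set G S \<and> isolating_set G S}"
    and "\<exists>S. independent_set G S \<and> isolating_set G S"
proof -
  interpret graph G by fact
  have "{S. independent_set G S \<and> isolating_set G S} \<subseteq> Pow (verts G)"
    by (auto simp: independent_set_def)
  then have "finite {S. independent_set G S \<and> isolating_set G S}"
    using finite_subset finite_verts by blast
  then show "finite {card S | S. independent_set G S \<and> isolating_set G S}"
    by simp
  have fin: "finite {S. independent_set G S}"
    by (rule finite_subset[of _ "Pow (verts G)"]) (auto simp: independent_set_def)
  have "independent_set G {}"
    by (simp add: independent_set_def)
  then obtain S where S: "independent_set G S"
    and max: "\<And>T. independent_set G T \<Longrightarrow> S \<subseteq> T \<Longrightarrow> T = S"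
    using finite_has_maximal2[OF fin, of "{}"] by auto
  have "v \<in> closed_nbhd G S" if v: "v \<in> verts G" for v
  proof (rule ccontr)
    assume nv: "v \<notin> closed_nbhd G S"
    have "\<not> v \<rightarrow>\<^bsub>G\<^esub> v"
      using adj_not_same by blast
    moreover have "\<not> u \<rightarrow>\<^bsub>G\<^esub> v" "\<not> v \<rightarrow>\<^bsub>G\<^esub> u" if "u \<in> S" for u
      using that nv arcs_ends_symmetric[OF sym_arcs]
      by (auto simp: closed_nbhd_def nbrs_def)
    ultimately have "independent_set G (insert v S)"
      using S v by (auto simp: independent_set_def)
    with max[of "insert v S"] nv show False
      by (auto simp: closed_nbhd_def)
  qed
  then have "isolating_set G S"
    using S by (auto simp: isolating_set_def independent_set_def)
  with S show "\<exists>S. independent_set G S \<and> isolating_set G S"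
    by blast
qed

end

theory Submission
  imports Defs
begin

text \<open>
  Read the three colors as residues modulo 3 and direct every edge from \<open>u\<close> to \<open>v\<close> when
  the color of \<open>v\<close> is one more than the color of \<open>u\<close>. An edge is bad exactly when each of
  its ends has all its neighbors in a single color, that is, when the edge runs from a
  source of this orientation to a sink (\<open>bad_edge_has_source\<close>). So it is enough to find a
  coloring whose only possible source is one prescribed vertex \<open>x\<close>: all bad edges then
  contain \<open>x\<close>.

  A source can be fired: lowering its color by one keeps the coloring proper and turns the
  source into a sink. Fire sources other than \<open>x\<close> for as long as there are any. Between two
  firings of a vertex each of its neighbors must fire, so firing counts of adjacent vertices
  differ by at most one; as \<open>x\<close> never fires, connectivity bounds the number of firings of
  every vertex (\<open>firing_counts_bounded\<close>) and the process stops. The proof below replaces the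
  process by its counts: the predicate \<open>firing_counts\<close> is a local invariant of firing, and
  counts with maximal sum yield a coloring without sources other than \<open>x\<close>
  (\<open>ex_coloring_unique_source\<close>).

  For the bound on the independent isolation number, a color class \<open>i\<close> leaves behind
  precisely the bad edges that miss the color \<open>i\<close>. Bad edges with a common vertex \<open>x\<close> all
  miss the same color \<open>m\<close>, and no neighbor of \<open>x\<close> has color \<open>m\<close>. Adding \<open>x\<close> to the class
  \<open>m\<close> therefore makes all three classes independent and isolating. Their sizes sum to at
  most \<open>n + 1\<close>, so one of them has at most \<open>(n + 1) / 3\<close> elements.
\<close>

section \<open>Bad edges join sources to sinks\<close>

definition source :: "('a, 'b) pre_digraph \<Rightarrow> ('a \<Rightarrow> nat) \<Rightarrow> 'a \<Rightarrow> bool" where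
  "source G c v \<longleftrightarrow> (\<forall>w \<in> nbrs G v. c w mod 3 = (c v + 1) mod 3)"

lemma missing_color_eq:
  assumes "c u \<in> {1, 2, 3}" "c v \<in> {1, 2, 3}" "c u \<noteq> c v"
  shows "missing_color c u v = 6 - c u - c v"
  unfolding missing_color_def
  by (rule the_equality) (use assms in auto)

context
  fixes G :: "('a, 'b) pre_digraph"
  assumes graph: "graph G"
begin

interpretation graph G by (rule graph)

lemma adj_sym: "u \<rightarrow>\<^bsub>G\<^esub> v \<Longrightarrow> v \<rightarrow>\<^bsub>G\<^esub> u"
  using arcs_ends_symmetric[OF sym_arcs] by blast

lemma proper_3_coloringD:
  assumes "proper_3_coloring G c" "u \<rightarrow>\<^bsub>G\<^esub> v"
  shows "c u \<in> {1, 2, 3}" "c v \<in> {1, 2, 3}" "c u \<noteq> c v"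
  using assms adj_in_verts unfolding proper_3_coloring_def by blast+

lemma adjacent_colors_consecutive:
  assumes "proper_3_coloring G c" "u \<rightarrow>\<^bsub>G\<^esub> v"
  shows "c v mod 3 = (c u + 1) mod 3 \<or> c u mod 3 = (c v + 1) mod 3"
  using proper_3_coloringD[OF assms] by auto

text \<open>
  The neighbors of both ends avoid the missing color, so those of \<open>u\<close> all have the color of
  \<open>v\<close> and those of \<open>v\<close> all have the color of \<open>u\<close>; the end whose color precedes the other is
  the source.
\<close>

lemma bad_edge_has_source:
  assumes c: "proper_3_coloring G c" and e: "e \<in> bad_edges G c"
  shows "\<exists>v \<in> e \<inter> verts G. source G c v"
proof -
  obtain u v where uv: "e = {u, v}" "u \<rightarrow>\<^bsub>G\<^esub> v"
    and bad: "\<And>w. w \<in> nbrs G u \<union> nbrs G v \<Longrightarrow> c w \<noteq> missing_color c u v"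
    using e unfolding bad_edges_def by blast
  note cuv = proper_3_coloringD[OF c uv(2)]
  have bad': "c w \<noteq> 6 - c u - c v" if "w \<in> nbrs G u \<union> nbrs G v" for w
    using bad[OF that] missing_color_eq[of c, OF cuv] by simp
  have nu: "c w = c v" if "w \<in> nbrs G u" for w
    using bad'[of w] that proper_3_coloringD[OF c, of u w] cuv
    by (auto simp: nbrs_def)
  have nv: "c w = c u" if "w \<in> nbrs G v" for w
    using bad'[of w] that proper_3_coloringD[OF c, of v w] cuv
    by (auto simp: nbrs_def)
  have "source G c u \<or> source G c v"
    using adjacent_colors_consecutive[OF c uv(2)] nu nv by (auto simp: source_def)
  then show ?thesis
    using uv adj_in_verts by blast
qed


section \<open>Firing sources\<close>

text \<open>
  On an edge that the initial coloring directs from \<open>u\<close> to \<open>v\<close> only \<open>u\<close> can fire first, and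
  then firings of \<open>v\<close> and \<open>u\<close> alternate; so at any time \<open>u\<close> is ahead of \<open>v\<close> by zero or one.
\<close>

definition firing_counts :: "('a \<Rightarrow> nat) \<Rightarrow> 'a \<Rightarrow> ('a \<Rightarrow> nat) \<Rightarrow> bool" where
  "firing_counts c x k \<longleftrightarrow> k x = 0 \<and>
     (\<forall>u v. u \<rightarrow>\<^bsub>G\<^esub> v \<longrightarrow> c v mod 3 = (c u + 1) mod 3 \<longrightarrow> k v \<le> k u \<and> k u \<le> k v + 1)"

text \<open>
  Each firing lowers the color by one, that is, raises it by two modulo 3. Adding 1 after
  the reduction permutes the colors cyclically and only serves to land in \<open>{1, 2, 3}\<close>.
\<close>

definition fired_coloring :: "('a \<Rightarrow> nat) \<Rightarrow> ('a \<Rightarrow> nat) \<Rightarrow> 'a \<Rightarrow> nat" where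
  "fired_coloring c k v = 1 + (c v + 2 * k v) mod 3"

lemma residue_successor_add:
  fixes a b j :: nat
  assumes "a mod 3 = (b + 1) mod 3"
  shows "(a + j) mod 3 = (b + j + 1) mod 3"
  using mod_add_cong[OF assms refl, of j] by (simp add: algebra_simps)

lemma residue_add_2_neq: "((a::nat) + 2) mod 3 \<noteq> a mod 3"
  by presburger

lemma fired_coloring_proper:
  assumes c: "proper_3_coloring G c" and k: "firing_counts c x k"
  shows "proper_3_coloring G (fired_coloring c k)"
proof -
  have step: "fired_coloring c k u \<noteq> fired_coloring c k v"
    if "u \<rightarrow>\<^bsub>G\<^esub> v" "c v mod 3 = (c u + 1) mod 3" for u v
  proof -
    have "k u = k v \<or> k u = k v + 1"
      using k that unfolding firing_counts_def by (metis le_SucE Suc_eq_plus1 le_antisym)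
    with residue_successor_add[OF that(2), of "2 * k v"] show ?thesis
      unfolding fired_coloring_def by (auto simp: mod_Suc split: if_splits)
  qed
  have "fired_coloring c k u \<noteq> fired_coloring c k v" if "u \<rightarrow>\<^bsub>G\<^esub> v" for u v
    using adjacent_colors_consecutive[OF c that] step[of u v] step[of v u] that adj_sym
    by metis
  moreover have "fired_coloring c k v \<in> {1, 2, 3}" for v
    unfolding fired_coloring_def by auto
  ultimately show ?thesis
    unfolding proper_3_coloring_def by blast
qed

text \<open>
  Counts change by at most one along an edge, so the length of any walk from \<open>x\<close> to \<open>v\<close>
  is a bound.
\<close>

lemma firing_counts_bounded:
  assumes c: "proper_3_coloring G c" and "x \<rightarrow>\<^sup>*\<^bsub>G\<^esub> v"
  shows "\<exists>b. \<forall>k. firing_counts c x k \<longrightarrow> k v \<le> b"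
  using assms(2)
proof (induction rule: reachable_induct)
  case base
  then show ?case by (auto simp: firing_counts_def)
next
  case (step u v)
  then obtain b where b: "\<And>k. firing_counts c x k \<Longrightarrow> k u \<le> b" by blast
  have "k v \<le> b + 1" if k: "firing_counts c x k" for k
  proof -
    have "k v \<le> k u + 1"
      using adjacent_colors_consecutive[OF c \<open>u \<rightarrow>\<^bsub>G\<^esub> v\<close>] k \<open>u \<rightarrow>\<^bsub>G\<^esub> v\<close> adj_sym
      unfolding firing_counts_def by (metis trans_le_add1)
    with b[OF k] show ?thesis by simp
  qed
  then show ?case by blast
qed

lemma shifted_residue_successor:
  fixes a b :: nat
  assumes "(1 + a mod 3) mod 3 = (1 + b mod 3 + 1) mod 3"
  shows "a mod 3 = (b + 1) mod 3"
  using assms by (auto simp: mod_Suc split: if_splits)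

text \<open>
  This is where being a source matters: an edge that currently leaves \<open>v\<close> is one on which
  \<open>v\<close> is due to fire next, so the count of \<open>v\<close> may grow without breaking the invariant.
\<close>

lemma fire_source:
  assumes c: "proper_3_coloring G c" and k: "firing_counts c x k"
    and v: "source G (fired_coloring c k) v" "v \<noteq> x"
  shows "firing_counts c x (k(v := k v + 1))"
proof -
  have src: "(c w + 2 * k w) mod 3 = (c v + 2 * k v + 1) mod 3" if "v \<rightarrow>\<^bsub>G\<^esub> w" for w
  proof -
    have "(1 + (c w + 2 * k w) mod 3) mod 3 = (1 + (c v + 2 * k v) mod 3 + 1) mod 3"
      using v(1) that unfolding source_def fired_coloring_def nbrs_def by blast
    then show ?thesis by (rule shifted_residue_successor)
  qed
  have out: "k w = k v" if vw: "v \<rightarrow>\<^bsub>G\<^esub> w" "c w mod 3 = (c v + 1) mod 3" for w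
  proof (rule ccontr)
    assume "k w \<noteq> k v"
    then have "k v = k w + 1"
      using k vw unfolding firing_counts_def by (metis le_SucE Suc_eq_plus1 le_antisym)
    then have "c v + 2 * k v + 1 = (c v + 2 * k w + 1) + 2" by simp
    then show False
      using src[OF vw(1)] residue_successor_add[OF vw(2), of "2 * k w"] residue_add_2_neq
      by metis
  qed
  have inc: "k w = k v + 1" if wv: "w \<rightarrow>\<^bsub>G\<^esub> v" "c v mod 3 = (c w + 1) mod 3" for w
  proof (rule ccontr)
    assume "k w \<noteq> k v + 1"
    then have "k w = k v"
      using k wv unfolding firing_counts_def by (metis le_SucE Suc_eq_plus1 le_antisym)
    then have "c w + (2 * k v + 1) + 1 = (c w + 2 * k w) + 2" by simp
    then show False
      using src[OF adj_sym[OF wv(1)]] residue_successor_add[OF wv(2), of "2 * k v + 1"]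
        residue_add_2_neq
      by (metis add.assoc)
  qed
  show ?thesis
    unfolding firing_counts_def
  proof (intro conjI allI impI)
    show "(k(v := k v + 1)) x = 0"
      using k v(2) by (simp add: firing_counts_def)
  next
    fix a b assume ab: "a \<rightarrow>\<^bsub>G\<^esub> b" "c b mod 3 = (c a + 1) mod 3"
    then have old: "k b \<le> k a \<and> k a \<le> k b + 1"
      using k unfolding firing_counts_def by blast
    have ne: "a \<noteq> b" using proper_3_coloringD(3)[OF c ab(1)] by blast
    consider "a = v" "k b = k v" | "b = v" "k a = k v + 1" | "a \<noteq> v" "b \<noteq> v"
      using out inc ab by blast
    then show "(k(v := k v + 1)) b \<le> (k(v := k v + 1)) a"
      and "(k(v := k v + 1)) a \<le> (k(v := k v + 1)) b + 1"
      by (cases; use old ne in simp)+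
  qed
qed

lemma ex_coloring_unique_source:
  assumes conn: "Digraph_Component.connected G" and c: "proper_3_coloring G c"
    and x: "x \<in> verts G"
  shows "\<exists>c'. proper_3_coloring G c' \<and> (\<forall>v \<in> verts G. source G c' v \<longrightarrow> v = x)"
proof -
  have "strongly_connected G"
    using conn sym_arcs symmetric_connected_imp_strongly_connected by blast
  then have "\<exists>b. \<forall>k. firing_counts c x k \<longrightarrow> k v \<le> b" if "v \<in> verts G" for v
    using firing_counts_bounded[OF c] that x by blast
  then obtain b where b: "\<And>v k. v \<in> verts G \<Longrightarrow> firing_counts c x k \<Longrightarrow> k v \<le> b v"
    by metis
  have "sum k (verts G) < Suc (sum b (verts G))" if "firing_counts c x k" for k
    unfolding less_Suc_eq_le using b that by (intro sum_mono) blast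
  moreover have "firing_counts c x (\<lambda>_. 0)"
    by (simp add: firing_counts_def)
  ultimately obtain k where k: "firing_counts c x k"
    and max: "\<And>k'. firing_counts c x k' \<Longrightarrow> sum k' (verts G) \<le> sum k (verts G)"
    using ex_has_greatest_nat[of "firing_counts c x" "\<lambda>_. 0" "\<lambda>k. sum k (verts G)"
        "Suc (sum b (verts G))"] by blast
  have "v = x" if v: "v \<in> verts G" "source G (fired_coloring c k) v" for v
  proof (rule ccontr)
    assume "v \<noteq> x"
    then have "sum (k(v := k v + 1)) (verts G) \<le> sum k (verts G)"
      using fire_source[OF c k v(2)] max by blast
    moreover have "sum k (verts G) < sum (k(v := k v + 1)) (verts G)"
      using v(1) by (intro sum_strict_mono_ex1) auto
    ultimately show False by simp
  qed
  then show ?thesis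
    using fired_coloring_proper[OF c k] by blast
qed


section \<open>Color classes as isolating sets\<close>

definition color_class :: "('a \<Rightarrow> nat) \<Rightarrow> nat \<Rightarrow> 'a set" where
  "color_class c i = {v \<in> verts G. c v = i}"

lemma not_isolatingE:
  assumes "\<not> isolating_set G S" "S \<subseteq> verts G"
  obtains u v where "u \<rightarrow>\<^bsub>G\<^esub> v" "u \<notin> closed_nbhd G S" "v \<notin> closed_nbhd G S"
proof -
  obtain a where a: "a \<in> arcs (G \<restriction> (verts G - closed_nbhd G S))"
    using assms unfolding isolating_set_def by blast
  then have "tail G a \<rightarrow>\<^bsub>G\<^esub> head G a"
    by (auto intro: in_arcs_imp_in_arcs_ends)
  with a show thesis
    by (intro that) auto
qed

text \<open>
  Neither end of the edge has color \<open>i\<close>, so \<open>i\<close> is its missing color; a neighbor of an end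
  with color \<open>i\<close> would have put that end into the closed neighborhood of \<open>S\<close>.
\<close>

lemma surviving_edge_bad:
  assumes c: "proper_3_coloring G c" and i: "i \<in> {1, 2, 3}" and uv: "u \<rightarrow>\<^bsub>G\<^esub> v"
    and S: "color_class c i \<subseteq> S" "u \<notin> closed_nbhd G S" "v \<notin> closed_nbhd G S"
  shows "{u, v} \<in> bad_edges G c" "missing_color c u v = i"
proof -
  note cuv = proper_3_coloringD[OF c uv]
  have "c u \<noteq> i" "c v \<noteq> i"
    using S adj_in_verts[OF uv] by (auto simp: color_class_def closed_nbhd_def)
  then show m: "missing_color c u v = i"
    using missing_color_eq[of c, OF cuv] cuv i by auto
  have "c w \<noteq> i" if w: "w \<in> nbrs G u \<union> nbrs G v" for w
  proof
    assume "c w = i"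
    with w adj_in_verts have "w \<in> S"
      using S(1) by (auto simp: color_class_def nbrs_def)
    with w adj_sym S(2,3) show False
      unfolding closed_nbhd_def nbrs_def by blast
  qed
  with uv m show "{u, v} \<in> bad_edges G c"
    unfolding bad_edges_def by blast
qed

lemma color_class_independent:
  assumes "proper_3_coloring G c"
  shows "independent_set G (color_class c i)"
  unfolding independent_set_def color_class_def
  by (auto dest: proper_3_coloringD(3)[OF assms])

lemma card_color_classes:
  assumes "proper_3_coloring G c"
  shows "card (color_class c 1) + card (color_class c 2) + card (color_class c 3) = card (verts G)"
proof -
  have "card (verts G) = (\<Sum>i \<in> {1, 2, 3}. card (color_class c i))"
    unfolding color_class_def
    by (subst card_eq_sum, subst sum.group[symmetric, where g = c and T = "{1, 2, 3}"])
      (use assms in \<open>auto simp: proper_3_coloring_def\<close>)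
  then show ?thesis by simp
qed

lemma bad_edgeE:
  assumes "e \<in> bad_edges G c" "x \<in> e"
  obtains y where "e = {x, y}" "x \<rightarrow>\<^bsub>G\<^esub> y"
    "\<And>w. w \<in> nbrs G x \<union> nbrs G y \<Longrightarrow> c w \<noteq> missing_color c x y"
proof -
  obtain u v where uv: "e = {u, v}" "u \<rightarrow>\<^bsub>G\<^esub> v"
    "\<And>w. w \<in> nbrs G u \<union> nbrs G v \<Longrightarrow> c w \<noteq> missing_color c u v"
    using assms(1) unfolding bad_edges_def by blast
  have "missing_color c v u = missing_color c u v"
    by (simp add: missing_color_def insert_commute)
  with uv adj_sym assms(2) show thesis
    by (cases "x = u") (auto intro: that)
qed

text \<open>
  If \<open>{x, y}\<close> is bad with missing color \<open>m\<close>, no neighbor of \<open>x\<close> has color \<open>m\<close>. So \<open>x\<close> can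
  join the class \<open>m\<close>, and once it has joined it covers every bad edge. An edge left over by
  another class \<open>i\<close> would be bad, hence contain \<open>x\<close>, and miss \<open>i\<close>; then it would have an end
  of color \<open>m\<close>, which cannot be \<open>x\<close> and cannot be a neighbor of \<open>x\<close>.
\<close>

lemma independent_isolating_classes:
  assumes c: "proper_3_coloring G c"
    and common: "\<And>e. e \<in> bad_edges G c \<Longrightarrow> x \<in> e" and x: "x \<in> verts G"
  obtains m where "\<And>i. i \<in> {1, 2, 3} \<Longrightarrow>
    independent_set G (color_class c i \<union> (if i = m then {x} else {})) \<and>
    isolating_set G (color_class c i \<union> (if i = m then {x} else {}))"
proof (cases "bad_edges G c = {}")
  case True
  have "isolating_set G (color_class c i)" if "i \<in> {1, 2, 3}" for i
    using not_isolatingE[of "color_class c i"] surviving_edge_bad(1)[OF c that] True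
    by (metis color_class_independent[OF c] empty_iff independent_set_def order_refl)
  then show thesis
    \<comment> \<open>The number 0 is not a color, so \<open>x\<close> is added to no class.\<close>
    by (intro that[of 0]) (use color_class_independent[OF c] in auto)
next
  case False
  then obtain e where "e \<in> bad_edges G c" "x \<in> e"
    using common by blast
  then obtain y where y: "x \<rightarrow>\<^bsub>G\<^esub> y"
    and no_m: "\<And>w. x \<rightarrow>\<^bsub>G\<^esub> w \<Longrightarrow> c w \<noteq> missing_color c x y"
    by (elim bad_edgeE) (auto simp: nbrs_def)
  define m where "m = missing_color c x y"
  have m: "m \<in> {1, 2, 3}" "m \<noteq> c x"
    unfolding m_def missing_color_eq[of c, OF proper_3_coloringD[OF c y]]
    using proper_3_coloringD[OF c y] by auto
  define S where "S i = color_class c i \<union> (if i = m then {x} else {})" for i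
  have indep: "independent_set G (S i)" for i
  proof -
    have "\<not> x \<rightarrow>\<^bsub>G\<^esub> w" "\<not> w \<rightarrow>\<^bsub>G\<^esub> x" if "w \<in> color_class c m" for w
      using that no_m adj_sym adj_not_same unfolding color_class_def m_def by blast+
    moreover have "\<not> x \<rightarrow>\<^bsub>G\<^esub> x" using adj_not_same by blast
    ultimately show ?thesis
      using color_class_independent[OF c, of i] x
      unfolding S_def independent_set_def by (auto split: if_splits)
  qed
  have "isolating_set G (S i)" if i: "i \<in> {1, 2, 3}" for i
  proof (rule ccontr)
    assume "\<not> isolating_set G (S i)"
    moreover have "S i \<subseteq> verts G"
      using indep by (auto simp: independent_set_def)
    ultimately obtain u v where uv: "u \<rightarrow>\<^bsub>G\<^esub> v"
      and out: "u \<notin> closed_nbhd G (S i)" "v \<notin> closed_nbhd G (S i)"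
      by (rule not_isolatingE)
    have sub: "color_class c i \<subseteq> S i" by (auto simp: S_def)
    note bad = surviving_edge_bad[OF c i uv sub out]
    have xuv: "x \<in> {u, v}" using common bad(1) by blast
    show False
    proof (cases "i = m")
      case True
      then show False using xuv out by (auto simp: S_def closed_nbhd_def)
    next
      case False
      have "c u = m \<or> c v = m"
        using False bad(2)[unfolded missing_color_eq[of c, OF proper_3_coloringD[OF c uv]]]
          proper_3_coloringD[OF c uv] m(1) by auto
      then show False
        using xuv uv adj_sym[OF uv] no_m m(2) unfolding m_def[symmetric] by blast
    qed
  qed
  with indep show thesis
    using that[of m] unfolding S_def by blast
qed

lemma independent_isolation_number_le:
  assumes c: "proper_3_coloring G c"
    and common: "\<And>e. e \<in> bad_edges G c \<Longrightarrow> x \<in> e" and x: "x \<in> verts G"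
  shows "3 * independent_isolation_number G \<le> card (verts G) + 1"
proof -
  obtain m where m: "\<And>i. i \<in> {1, 2, 3} \<Longrightarrow>
    independent_set G (color_class c i \<union> (if i = m then {x} else {})) \<and>
    isolating_set G (color_class c i \<union> (if i = m then {x} else {}))"
    using independent_isolating_classes[OF c common x] by blast
  have "independent_isolation_number G \<le> card (color_class c i) + (if i = m then 1 else 0)"
    if "i \<in> {1, 2, 3}" for i
  proof -
    have "independent_isolation_number G \<le> card (color_class c i \<union> (if i = m then {x} else {}))"
      unfolding independent_isolation_number_def
      using ex_independent_isolating_set(1)[OF graph] m[OF that] by (intro Min_le) blast+
    also have "\<dots> \<le> card (color_class c i) + card (if i = m then {x} else {})"
      by (rule card_Un_le)
    finally show ?thesis by (simp split: if_splits)
  qed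
  from this[of 1] this[of 2] this[of 3] show ?thesis
    using card_color_classes[OF c] by (simp split: if_splits)
qed

end


section \<open>The coloring and the bound\<close>

theorem theorem6:
  fixes G :: "('a, 'b) pre_digraph" and n :: nat
  assumes "graph G"
    and "Digraph_Component.connected G"
    and "three_colorable G"
    and "card (verts G) = n"
  shows "(\<exists>c. proper_3_coloring G c \<and>
             (bad_edges G c \<noteq> {} \<longrightarrow> (\<exists>x \<in> verts G. \<forall>e \<in> bad_edges G c. x \<in> e)))
         \<and> real (independent_isolation_number G) \<le> (real n + 1) / 3"
proof -
  obtain x where x: "x \<in> verts G"
    using assms(2) unfolding Digraph_Component.connected_def strongly_connected_def by auto
  obtain c where c: "proper_3_coloring G c"
    and src: "\<And>v. v \<in> verts G \<Longrightarrow> source G c v \<Longrightarrow> v = x"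
    using ex_coloring_unique_source[OF assms(1,2) _ x] assms(3)
    unfolding three_colorable_def by blast
  have common: "x \<in> e" if "e \<in> bad_edges G c" for e
    using bad_edge_has_source[OF assms(1) c that] src by blast
  have "3 * independent_isolation_number G \<le> n + 1"
    using independent_isolation_number_le[OF assms(1) c common x] assms(4) by simp
  then have "real (3 * independent_isolation_number G) \<le> real (n + 1)"
    by (simp only: of_nat_le_iff)
  then have "real (independent_isolation_number G) \<le> (real n + 1) / 3"
    by simp
  with c common x show ?thesis by blast
qed

end
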